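(* Let $G=(\mathcal V,\mathcal E,\mathcal S)$ be a finite connected undirected graph with binary sensitive attribute $\mathcal S:\mathcal V\to\{0,1\}$, and let $h:\mathcal V\times\mathcal V\to[0,1]$ be a link predictor. Let $(V,V')$ be drawn uniformly from $\mathcal V\times\mathcal V$, let $S=\mathcal S(V)$, $S'=\mathcal S(V')$, $\hat Y=h(V,V')$, and let $$\Delta DP=\big|\mathbb E[\hat Y\mid S=S']-\mathbb E[\hat Y\mid S\neq S']\big|.$$ Then $$\Delta DP=\Big|\sum_{k\in\mathcal K}\ \sum_{v\in\mathcal V^{(k)}}\omega^{(k)}(v)\Big(\frac{f^{(k)}_{\mathrm{same}}(v)}{\mathbb P(S=S')}-\frac{f^{(k)}_{\mathrm{diff}}(v)}{\mathbb P(S\neq S')}\Big)\Big|,$$ where $f^{(k)}_{\mathrm{same}}(v)=f^{(k)}_{\mathcal S(v)}(v)$ and $f^{(k)}_{\mathrm{diff}}(v)=f^{(k)}_{1-\mathcal S(v)}(v)$ are the within-group and cross-group exposures, respectively, and $\omega^{(k)}(v)=\mathbb P(V=v,\ \sigma(V,V')=k)$.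
   Context: $\sigma(v,v')$ is the length of a shortest path between $v,v'\in\mathcal V$. $N^{(k)}(v)=\{v'\in\mathcal V:\sigma(v,v')=k\}$ is the set of $k$-hop neighbors of $v$, $\mathcal V^{(k)}=\{v\in\mathcal V: N^{(k)}(v)\ne\varnothing\}$, and $\mathcal K=\{k\in\mathbb N,\ k\ge 1:\mathcal V^{(k)}\neq\varnothing\}$. For $s\in\{0,1\}$, $k\in\mathcal K$ and $v\in\mathcal V^{(k)}$, the $k$-hop node attribute exposure (with the predictor $h$ left implicit) is $$f^{(k)}_s(v)=\mathbb E\big[h(V,V')\,\mathbf 1_{\{S'=s\}}\ \big|\ \sigma(V,V')=k,\ V=v\big].$$
   Formalization: The stated identity fails since pairs with V=V' count in ΔDP but K has only k≥1 (one edge, differing attributes, h=1: 0 versus 1); proved instead are the stated formula when h(v,v)=0 for all v, and, for every h, the formula with the k=0 term added to the sum. *)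

theory Defs
  imports "HOL-Probability.Probability" "Graph_Theory.Digraph_Component"
begin

(* The least element is taken over a nonempty set exactly when v is reachable from u, in particular
   for all vertices of a connected undirected graph.  The empty path gives
   distance 0 from a vertex to itself. *)
definition hop_dist :: "('v, 'e) pre_digraph \<Rightarrow> 'v \<Rightarrow> 'v \<Rightarrow> nat" where
  "hop_dist G u v = (LEAST n. \<exists>p. pre_digraph.apath G u p v \<and> length p = n)"

definition hop_nbrs :: "('v, 'e) pre_digraph \<Rightarrow> nat \<Rightarrow> 'v \<Rightarrow> 'v set" where
  "hop_nbrs G k v = {v' \<in> verts G. hop_dist G v v' = k}"

definition hop_verts :: "('v, 'e) pre_digraph \<Rightarrow> nat \<Rightarrow> 'v set" where
  "hop_verts G k = {v \<in> verts G. hop_nbrs G k v \<noteq> {}}"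

definition hop_range :: "('v, 'e) pre_digraph \<Rightarrow> nat set" where
  "hop_range G = {k. k \<ge> 1 \<and> hop_verts G k \<noteq> {}}"

(* Elementary conditional expectation E[X | P] = E[X 1_P] / P(P) given an event;
   by the convention x / 0 = 0 it is 0 when the event is null. *)
definition cond_expect :: "'a pmf \<Rightarrow> ('a \<Rightarrow> real) \<Rightarrow> ('a \<Rightarrow> bool) \<Rightarrow> real" where
  "cond_expect M X P =
     measure_pmf.expectation M (\<lambda>\<omega>. X \<omega> * of_bool (P \<omega>)) / measure_pmf.prob M {\<omega>. P \<omega>}"

(* The law of (V, V'), uniform on all ordered pairs.  It charges the diagonal
   V = V', at distance 0, which hop_range leaves out. *)
definition node_pair :: "('v, 'e) pre_digraph \<Rightarrow> ('v \<times> 'v) pmf" where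
  "node_pair G = pmf_of_set (verts G \<times> verts G)"

definition prob_same :: "('v, 'e) pre_digraph \<Rightarrow> ('v \<Rightarrow> nat) \<Rightarrow> real" where
  "prob_same G S = measure_pmf.prob (node_pair G) {(x, y). S x = S y}"

definition prob_diff :: "('v, 'e) pre_digraph \<Rightarrow> ('v \<Rightarrow> nat) \<Rightarrow> real" where
  "prob_diff G S = measure_pmf.prob (node_pair G) {(x, y). S x \<noteq> S y}"

definition delta_DP ::
    "('v, 'e) pre_digraph \<Rightarrow> ('v \<Rightarrow> nat) \<Rightarrow> ('v \<Rightarrow> 'v \<Rightarrow> real) \<Rightarrow> real" where
  "delta_DP G S h =
     \<bar>cond_expect (node_pair G) (\<lambda>(x, y). h x y) (\<lambda>(x, y). S x = S y)
      - cond_expect (node_pair G) (\<lambda>(x, y). h x y) (\<lambda>(x, y). S x \<noteq> S y)\<bar>"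

definition exposure ::
    "('v, 'e) pre_digraph \<Rightarrow> ('v \<Rightarrow> nat) \<Rightarrow> ('v \<Rightarrow> 'v \<Rightarrow> real) \<Rightarrow> nat \<Rightarrow> nat \<Rightarrow> 'v \<Rightarrow> real" where
  "exposure G S h k s v =
     cond_expect (node_pair G) (\<lambda>(x, y). h x y * of_bool (S y = s))
       (\<lambda>(x, y). hop_dist G x y = k \<and> x = v)"

definition exposure_same ::
    "('v, 'e) pre_digraph \<Rightarrow> ('v \<Rightarrow> nat) \<Rightarrow> ('v \<Rightarrow> 'v \<Rightarrow> real) \<Rightarrow> nat \<Rightarrow> 'v \<Rightarrow> real" where
  "exposure_same G S h k v = exposure G S h k (S v) v"

(* S takes values in {0, 1}, so the truncated subtraction is exact. *)
definition exposure_diff ::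
    "('v, 'e) pre_digraph \<Rightarrow> ('v \<Rightarrow> nat) \<Rightarrow> ('v \<Rightarrow> 'v \<Rightarrow> real) \<Rightarrow> nat \<Rightarrow> 'v \<Rightarrow> real" where
  "exposure_diff G S h k v = exposure G S h k (1 - S v) v"

definition hop_weight :: "('v, 'e) pre_digraph \<Rightarrow> nat \<Rightarrow> 'v \<Rightarrow> real" where
  "hop_weight G k v =
     measure_pmf.prob (node_pair G) {(x, y). x = v \<and> hop_dist G x y = k}"

end

theory Submission
  imports Defs
begin

(* Conditioning on the event of a given source v and a given distance k, then weighting by the
   probability of that event, recovers the restricted expectation E[X 1_{V = v, d(V,V') = k}].  These
   events partition the vertex pairs, so the weighted exposures sum to the numerators of the two
   conditional expectations in delta_DP.  The distance-0 event is the diagonal, by connectedness. *)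

text \<open>On a null event the left side has a factor 0 and the integrand on the right vanishes
  almost surely; otherwise the probability cancels the denominator. Weighted exposures thus need no
  positivity check.\<close>

lemma prob_mult_cond_expect:
  fixes M :: "'a pmf"
  shows "measure_pmf.prob M {\<omega>. P \<omega>} * cond_expect M X P =
    measure_pmf.expectation M (\<lambda>\<omega>. X \<omega> * of_bool (P \<omega>))"
proof (cases "measure_pmf.prob M {\<omega>. P \<omega>} = 0")
  case True
  then have "AE \<omega> in M. \<not> P \<omega>"
    by (simp add: measure_pmf_zero_iff AE_measure_pmf_iff disjoint_iff)
  then have "measure_pmf.expectation M (\<lambda>\<omega>. X \<omega> * of_bool (P \<omega>)) = measure_pmf.expectation M (\<lambda>\<omega>. 0)"
    by (intro integral_cong_AE) auto
  with True show ?thesis by simp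
qed (simp add: cond_expect_def)

text \<open>Reachability supplies a path, so the \<open>LEAST\<close> in \<open>hop_dist\<close> is
  attained, and a path without arcs joins a vertex only to itself.\<close>

lemma (in wf_digraph) hop_dist_eq_0_iff:
  assumes "u \<rightarrow>\<^sup>* v"
  shows "hop_dist G u v = 0 \<longleftrightarrow> u = v"
proof
  assume 0: "hop_dist G u v = 0"
  obtain p where "apath u p v"
    using assms reachable_apath by auto
  then have "\<exists>n p. apath u p v \<and> length p = n"
    by blast
  then have "\<exists>p. apath u p v \<and> length p = hop_dist G u v"
    unfolding hop_dist_def by (rule LeastI_ex)
  with 0 show "u = v"
    by (simp add: apath_Nil_iff)
next
  assume "u = v"
  with assms have "apath u [] v"
    by (simp add: apath_Nil_iff reachable_in_verts)
  then show "hop_dist G u v = 0"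
    unfolding hop_dist_def by (intro Least_eq_0) auto
qed

text \<open>Finiteness keeps sums over \<open>hop_range G\<close> from collapsing to the default
  value 0.\<close>

lemma finite_hop_range:
  assumes "finite (verts G)"
  shows "finite (hop_range G)"
proof (rule finite_subset)
  show "hop_range G \<subseteq> (\<lambda>(u, v). hop_dist G u v) ` (verts G \<times> verts G)"
    by (auto simp: hop_range_def hop_verts_def hop_nbrs_def)
  show "finite ((\<lambda>(u, v). hop_dist G u v) ` (verts G \<times> verts G))"
    using assms by simp
qed

text \<open>The vertex \<open>v\<close> witnesses that its own distance from \<open>u\<close>
  occurs; only the bound \<open>k \<ge> 1\<close> keeps distance 0 out of the range.\<close>

lemma hop_dist_in_insert_0_hop_range:
  assumes "u \<in> verts G" "v \<in> verts G"
  shows "hop_dist G u v \<in> insert 0 (hop_range G)"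
  using assms by (auto simp: hop_range_def hop_verts_def hop_nbrs_def)

lemma set_node_pair:
  assumes "finite (verts G)" "verts G \<noteq> {}"
  shows "set_pmf (node_pair G) = verts G \<times> verts G"
  unfolding node_pair_def using assms by (intro set_pmf_of_set) auto

lemma integrable_node_pair:
  fixes f :: "'v \<times> 'v \<Rightarrow> real"
  assumes "finite (verts G)" "verts G \<noteq> {}"
  shows "integrable (measure_pmf (node_pair G)) f"
  using assms by (intro integrable_measure_pmf_finite) (simp add: set_node_pair)

lemma expectation_node_pair_cong:
  fixes f g :: "'v \<times> 'v \<Rightarrow> real"
  assumes "finite (verts G)" "verts G \<noteq> {}"
    and "\<And>x y. x \<in> verts G \<Longrightarrow> y \<in> verts G \<Longrightarrow> f (x, y) = g (x, y)"
  shows "measure_pmf.expectation (node_pair G) f = measure_pmf.expectation (node_pair G) g"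
  using assms by (intro integral_cong_AE) (auto simp: AE_measure_pmf_iff set_node_pair)

text \<open>A vertex pair \<open>(x, y)\<close> has a nonzero indicator at just one index,
  \<open>k = hop_dist G x y\<close> and \<open>v = x\<close>. If this \<open>k\<close> lies outside
  \<open>K\<close>, then \<open>zero\<close> says that nothing is lost.\<close>

lemma sum_expectation_hop:
  fixes X :: "'v \<times> 'v \<Rightarrow> real"
  assumes fin: "finite (verts G)" "verts G \<noteq> {}" and K: "finite K"
    and zero: "\<And>x y. x \<in> verts G \<Longrightarrow> y \<in> verts G \<Longrightarrow> hop_dist G x y \<notin> K \<Longrightarrow> X (x, y) = 0"
  shows "(\<Sum>k\<in>K. \<Sum>v\<in>hop_verts G k. measure_pmf.expectation (node_pair G)
      (\<lambda>(x, y). X (x, y) * of_bool (hop_dist G x y = k \<and> x = v))) =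
    measure_pmf.expectation (node_pair G) X"
proof -
  have fv: "finite (hop_verts G k)" for k
    using fin by (simp add: hop_verts_def)
  \<comment> \<open>Linearity moves the sums inside the expectation, leaving an identity to check
    pair by pair.\<close>
  have "(\<Sum>k\<in>K. \<Sum>v\<in>hop_verts G k. measure_pmf.expectation (node_pair G)
      (\<lambda>(x, y). X (x, y) * of_bool (hop_dist G x y = k \<and> x = v))) =
    measure_pmf.expectation (node_pair G) (\<lambda>\<omega>. \<Sum>k\<in>K. \<Sum>v\<in>hop_verts G k.
      (case \<omega> of (x, y) \<Rightarrow> X (x, y) * of_bool (hop_dist G x y = k \<and> x = v)))"
    using fin by (simp add: Bochner_Integration.integral_sum integrable_node_pair)
  also have "\<dots> = measure_pmf.expectation (node_pair G) X"
  proof (rule expectation_node_pair_cong[OF fin])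
    fix x y assume xy: "x \<in> verts G" "y \<in> verts G"
    let ?d = "hop_dist G x y"
    \<comment> \<open>Since \<open>y\<close> lies at distance \<open>?d\<close>, the index
      \<open>x\<close> does occur in the inner sum.\<close>
    have x: "x \<in> hop_verts G ?d"
      using xy by (auto simp: hop_verts_def hop_nbrs_def)
    have "(\<Sum>v\<in>hop_verts G k. X (x, y) * of_bool (?d = k \<and> x = v)) = (if ?d = k then X (x, y) else 0)" for k
    proof (cases "?d = k")
      case True
      then have "(\<Sum>v\<in>hop_verts G k. X (x, y) * of_bool (?d = k \<and> x = v)) =
          (\<Sum>v\<in>hop_verts G k. if x = v then X (x, y) else 0)"
        by (intro sum.cong) auto
      with True x fv show ?thesis by simp
    qed simp
    then show "(\<Sum>k\<in>K. \<Sum>v\<in>hop_verts G k.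
        (case (x, y) of (x, y) \<Rightarrow> X (x, y) * of_bool (hop_dist G x y = k \<and> x = v))) = X (x, y)"
      using K zero[OF xy] by simp
  qed
  finally show ?thesis .
qed

lemma hop_weight_mult_exposure:
  "hop_weight G k v * exposure G S h k s v =
    measure_pmf.expectation (node_pair G)
      (\<lambda>(x, y). h x y * of_bool (S y = s) * of_bool (hop_dist G x y = k \<and> x = v))"
proof -
  \<comment> \<open>The weight is the probability of the very event on which the exposure
    conditions, up to the order of the conjuncts.\<close>
  have "hop_weight G k v =
      measure_pmf.prob (node_pair G) {\<omega>. (\<lambda>(x, y). hop_dist G x y = k \<and> x = v) \<omega>}"
    unfolding hop_weight_def by (rule arg_cong[where f = "measure_pmf.prob _"]) auto
  then show ?thesis
    unfolding exposure_def
    by (simp only: prob_mult_cond_expect) (rule Bochner_Integration.integral_cong; auto)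
qed

text \<open>Letting the target attribute \<open>s\<close> depend on the source treats both exposures
  at once: \<open>S x\<close> gives the within-group relation, \<open>1 - S x\<close> the
  cross-group one.\<close>

lemma sum_hop_weight_mult_exposure:
  fixes h :: "'v \<Rightarrow> 'v \<Rightarrow> real"
  assumes fin: "finite (verts G)" "verts G \<noteq> {}" and "finite K"
    and zero: "\<And>x y. x \<in> verts G \<Longrightarrow> y \<in> verts G \<Longrightarrow> hop_dist G x y \<notin> K \<Longrightarrow> h x y = 0"
    and s: "\<And>x y. x \<in> verts G \<Longrightarrow> y \<in> verts G \<Longrightarrow> S y = s x \<longleftrightarrow> R x y"
  shows "(\<Sum>k\<in>K. \<Sum>v\<in>hop_verts G k. hop_weight G k v * exposure G S h k (s v) v) =
    measure_pmf.expectation (node_pair G) (\<lambda>(x, y). h x y * of_bool (R x y))"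
proof -
  have "(\<Sum>k\<in>K. \<Sum>v\<in>hop_verts G k. hop_weight G k v * exposure G S h k (s v) v) =
    (\<Sum>k\<in>K. \<Sum>v\<in>hop_verts G k. measure_pmf.expectation (node_pair G)
      (\<lambda>(x, y). (\<lambda>(x, y). h x y * of_bool (R x y)) (x, y) * of_bool (hop_dist G x y = k \<and> x = v)))"
    \<comment> \<open>The indicator of \<open>x = v\<close> turns \<open>s v\<close> into
      \<open>s x\<close>, so that \<open>S y = s v\<close> becomes \<open>R x y\<close>.\<close>
    unfolding hop_weight_mult_exposure
    by (intro sum.cong refl expectation_node_pair_cong[OF fin]) (auto simp: s)
  also have "\<dots> = measure_pmf.expectation (node_pair G) (\<lambda>(x, y). h x y * of_bool (R x y))"
    using assms by (intro sum_expectation_hop) auto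
  finally show ?thesis .
qed

text \<open>An abstract \<open>K\<close> serves both sums of the theorem: \<open>zero\<close> holds
  when \<open>K\<close> contains all distances between vertices, or when \<open>h\<close> vanishes
  on the pairs left out. If a group probability is 0, both sides drop its term by
  \<open>x / 0 = 0\<close>.\<close>

lemma delta_DP_eq_sum_exposure:
  fixes h :: "'v \<Rightarrow> 'v \<Rightarrow> real"
  assumes fin: "finite (verts G)" "verts G \<noteq> {}" and K: "finite K"
    and zero: "\<And>x y. x \<in> verts G \<Longrightarrow> y \<in> verts G \<Longrightarrow> hop_dist G x y \<notin> K \<Longrightarrow> h x y = 0"
    and S: "\<forall>v\<in>verts G. S v \<in> {0, 1}"
  shows "delta_DP G S h =
    \<bar>\<Sum>k\<in>K. \<Sum>v\<in>hop_verts G k. hop_weight G k v *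
       (exposure_same G S h k v / prob_same G S - exposure_diff G S h k v / prob_diff G S)\<bar>"
proof -
  have same: "(\<Sum>k\<in>K. \<Sum>v\<in>hop_verts G k. hop_weight G k v * exposure_same G S h k v) =
      measure_pmf.expectation (node_pair G) (\<lambda>(x, y). h x y * of_bool (S x = S y))"
    unfolding exposure_same_def
    by (rule sum_hop_weight_mult_exposure[OF fin K]) (auto simp: zero)
  have diff: "(\<Sum>k\<in>K. \<Sum>v\<in>hop_verts G k. hop_weight G k v * exposure_diff G S h k v) =
      measure_pmf.expectation (node_pair G) (\<lambda>(x, y). h x y * of_bool (S x \<noteq> S y))"
    unfolding exposure_diff_def
  proof (rule sum_hop_weight_mult_exposure[OF fin K])
    \<comment> \<open>This is where the attribute being binary enters.\<close>
    show "S y = 1 - S x \<longleftrightarrow> S x \<noteq> S y" if "x \<in> verts G" "y \<in> verts G" for x y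
      using S[rule_format, OF that(1)] S[rule_format, OF that(2)] by (elim insertE emptyE) simp_all
  qed (fact zero)
  have "(\<Sum>k\<in>K. \<Sum>v\<in>hop_verts G k. hop_weight G k v *
       (exposure_same G S h k v / prob_same G S - exposure_diff G S h k v / prob_diff G S)) =
    (\<Sum>k\<in>K. \<Sum>v\<in>hop_verts G k. hop_weight G k v * exposure_same G S h k v) / prob_same G S -
    (\<Sum>k\<in>K. \<Sum>v\<in>hop_verts G k. hop_weight G k v * exposure_diff G S h k v) / prob_diff G S"
    by (simp add: right_diff_distrib sum_subtractf sum_divide_distrib)
  then show ?thesis
    unfolding same diff delta_DP_def cond_expect_def prob_same_def prob_diff_def
    by (simp add: case_prod_unfold)
qed

text \<open>The diagonal has positive probability and contributes to \<open>delta_DP\<close>, but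
  \<open>hop_range\<close> starts at distance 1. Hence the sum over \<open>hop_range\<close> is
  asserted for predictors that vanish on the diagonal, and the general identity adds the term
  \<open>k = 0\<close>.\<close>

theorem mainTheorem1:
  fixes G :: "('v, 'e) pre_digraph"
    and S :: "'v \<Rightarrow> nat"
    and h :: "'v \<Rightarrow> 'v \<Rightarrow> real"
  assumes "pseudo_graph G"
    and "Digraph_Component.connected G"
    and "\<forall>v \<in> verts G. S v \<in> {0, 1}"
    and "\<forall>u \<in> verts G. \<forall>v \<in> verts G. h u v \<in> {0..1}"
  shows
    "((\<forall>v \<in> verts G. h v v = 0) \<longrightarrow>
       delta_DP G S h =
         \<bar>\<Sum>k \<in> hop_range G. \<Sum>v \<in> hop_verts G k.
            hop_weight G k v *
              (exposure_same G S h k v / prob_same G S - exposure_diff G S h k v / prob_diff G S)\<bar>)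
     \<and> delta_DP G S h =
         \<bar>\<Sum>k \<in> insert 0 (hop_range G). \<Sum>v \<in> hop_verts G k.
            hop_weight G k v *
              (exposure_same G S h k v / prob_same G S - exposure_diff G S h k v / prob_diff G S)\<bar>"
proof (intro conjI impI)
  interpret pseudo_graph G by fact
  \<comment> \<open>Arcs are symmetric, so undirected connectedness yields the directed paths that
    \<open>hop_dist\<close> measures.\<close>
  have conn: "strongly_connected G"
    using symmetric_connected_imp_strongly_connected[OF sym_arcs assms(2)] .
  then have ne: "verts G \<noteq> {}"
    by (simp add: strongly_connected_def)
  have K: "finite (hop_range G)"
    by (simp add: finite_hop_range)
  show "delta_DP G S h =
     \<bar>\<Sum>k \<in> insert 0 (hop_range G). \<Sum>v \<in> hop_verts G k.
        hop_weight G k v *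
          (exposure_same G S h k v / prob_same G S - exposure_diff G S h k v / prob_diff G S)\<bar>"
  proof (rule delta_DP_eq_sum_exposure[OF finite_verts ne _ _ assms(3)])
    show "finite (insert 0 (hop_range G))"
      using K by simp
    \<comment> \<open>Vacuous: with 0 included, every distance between vertices is covered.\<close>
    show "h x y = 0" if "x \<in> verts G" "y \<in> verts G" "hop_dist G x y \<notin> insert 0 (hop_range G)" for x y
      using hop_dist_in_insert_0_hop_range[OF that(1,2)] that(3) by (rule notE[rotated])
  qed
  assume diag: "\<forall>v \<in> verts G. h v v = 0"
  show "delta_DP G S h =
     \<bar>\<Sum>k \<in> hop_range G. \<Sum>v \<in> hop_verts G k.
        hop_weight G k v *
          (exposure_same G S h k v / prob_same G S - exposure_diff G S h k v / prob_diff G S)\<bar>"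
  proof (rule delta_DP_eq_sum_exposure[OF finite_verts ne K _ assms(3)])
    \<comment> \<open>The pairs left out are at distance 0, hence on the diagonal, where
      \<open>h\<close> vanishes by \<open>diag\<close>.\<close>
    fix x y assume xy: "x \<in> verts G" "y \<in> verts G" "hop_dist G x y \<notin> hop_range G"
    then have "hop_dist G x y = 0"
      using hop_dist_in_insert_0_hop_range[of x G y] by simp
    moreover have "x \<rightarrow>\<^sup>*\<^bsub>G\<^esub> y"
      using conn xy by (simp add: strongly_connected_def)
    ultimately have "x = y"
      by (simp add: hop_dist_eq_0_iff)
    with diag xy show "h x y = 0" by simp
  qed
qed

end
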